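(* Let $p$ be a positive integer and $q\in(0,1)$. Let $s,t$ be real numbers with $s\ne t$, let $\alpha=\min\{s,t\}$, and let $\beta>-\alpha$. For $x\in(-\alpha,\infty)$ define $$h_{\beta,p,q}(x)=\begin{cases}\left[\dfrac{\Gamma_{p,q}(\beta+t)}{\Gamma_{p,q}(\beta+s)}\cdot\dfrac{\Gamma_{p,q}(x+s)}{\Gamma_{p,q}(x+t)}\right]^{\frac{1}{x-\beta}}, & x\ne\beta,\\[10pt] \exp\left[\psi_{p,q}(\beta+s)-\psi_{p,q}(\beta+t)\right], & x=\beta.\end{cases}$$ If $s>t$, then $h_{\beta,p,q}$ is logarithmically completely monotonic on $(-\alpha,+\infty)$.
   Context: For $q\in(0,1)$ and real $x$, $[x]_q=\frac{1-q^x}{1-q}$, and for a positive integer $p$, $[p]_q!=[1]_q[2]_q\cdots[p]_q$. For $x>0$, $\Gamma_{p,q}(x)=\frac{[p]_q^{x}\,[p]_q!}{[x]_q[x+1]_q\cdots[x+p]_q}$ and $\psi_{p,q}(x)=\frac{d}{dx}\log\Gamma_{p,q}(x)$. A positive function $f$ on an open interval $I$ is logarithmically completely monotonic on $I$ if it has derivatives of all orders on $I$ and $(-1)^n[\ln f(x)]^{(n)}\ge0$ for all $x\in I$ and all $n=1,2,\ldots$. *)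

theory Defs
  imports "HOL-Analysis.Analysis"
begin

definition qnum :: "real \<Rightarrow> real \<Rightarrow> real" where
  "qnum q x = (1 - q powr x) / (1 - q)"

definition qfact :: "real \<Rightarrow> nat \<Rightarrow> real" where
  "qfact q p = (\<Prod>k=1..p. qnum q (real k))"

text \<open>
  Intended for positive \<open>p\<close> and \<open>x\<close> and \<open>0 < q < 1\<close>. For \<open>x \<le> 0\<close> the formula still denotes
  a real number (with division by zero yielding zero), but it is not used there.
\<close>

definition Gamma_pq :: "nat \<Rightarrow> real \<Rightarrow> real \<Rightarrow> real" where
  "Gamma_pq p q x = (qnum q (real p) powr x * qfact q p) / (\<Prod>k=0..p. qnum q (x + real k))"

definition psi_pq :: "nat \<Rightarrow> real \<Rightarrow> real \<Rightarrow> real" where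
  "psi_pq p q x = deriv (\<lambda>y. ln (Gamma_pq p q y)) x"

text \<open>
  Since \<^term>\<open>deriv\<close> is a total function, existence of the derivatives of all orders is
  demanded explicitly: every iterated derivative is differentiable at every point of \<^term>\<open>I\<close>.
  As \<^term>\<open>I\<close> is open, values of \<^term>\<open>f\<close> outside \<^term>\<open>I\<close> play no role.
\<close>

definition log_completely_monotonic_on :: "(real \<Rightarrow> real) \<Rightarrow> real set \<Rightarrow> bool" where
  "log_completely_monotonic_on f I \<longleftrightarrow>
     open I \<and> is_interval I \<and>
     (\<forall>x\<in>I. f x > 0) \<and>
     (\<forall>n. \<forall>x\<in>I. (deriv ^^ n) f differentiable (at x)) \<and>
     (\<forall>n\<ge>1. \<forall>x\<in>I. (-1) ^ n * (deriv ^^ n) (\<lambda>y. ln (f y)) x \<ge> 0)"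

definition h_pq :: "real \<Rightarrow> nat \<Rightarrow> real \<Rightarrow> real \<Rightarrow> real \<Rightarrow> real \<Rightarrow> real" where
  "h_pq \<beta> p q s t x =
     (if x \<noteq> \<beta>
      then (Gamma_pq p q (\<beta> + t) / Gamma_pq p q (\<beta> + s)
            * (Gamma_pq p q (x + s) / Gamma_pq p q (x + t))) powr (1 / (x - \<beta>))
      else exp (psi_pq p q (\<beta> + s) - psi_pq p q (\<beta> + t)))"

end

theory Submission
  imports Defs
begin

text \<open>
  The logarithm of \<^term>\<open>h_pq \<beta> p q s t\<close> is the divided difference at \<open>\<beta>\<close> of
  \<open>G x = ln (Gamma_pq p q (x + s)) - ln (Gamma_pq p q (x + t))\<close>, the value at \<open>\<beta>\<close> being the
  limit \<open>G' \<beta>\<close>. By the fundamental theorem of calculus it equals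
  \<open>\<integral>\<^sub>0\<^sup>1 G' (\<beta> + u (x - \<beta>)) du\<close> for every \<open>x\<close>, and differentiation under the integral sign gives
  its derivatives \<open>\<integral>\<^sub>0\<^sup>1 u\<^sup>n G\<^sup>(\<^sup>n\<^sup>+\<^sup>1\<^sup>) (\<beta> + u (x - \<beta>)) du\<close>
  (lemma \<open>divided_difference_derivs_step\<close>). So everything reduces to
  \<open>(-1)\<^sup>n G\<^sup>(\<^sup>n\<^sup>+\<^sup>1\<^sup>) \<ge> 0\<close>, that is, to the complete monotonicity of \<open>G'\<close>.

  For this sign, put \<open>w y = q\<^sup>y / (1 - q\<^sup>y)\<close>, so that the logarithmic derivative of \<open>[y]\<^sub>q\<close> is
  \<open>- ln q * w y\<close> and \<open>w\<close> satisfies the differential equation \<open>w' = ln q * w * (1 + w)\<close>. Hence the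
  \<open>n\<close>-th derivative of \<open>w\<close> is \<open>(ln q)\<^sup>n\<close> times a polynomial in \<open>w\<close>, and
  the recursion for these polynomials shows that their coefficients are nonnegative; they are
  therefore increasing on the nonnegative axis. As \<open>w\<close> is decreasing, \<open>s > t\<close> fixes the sign of
  each summand of \<open>G\<^sup>(\<^sup>n\<^sup>+\<^sup>1\<^sup>)\<close>.
\<close>

section \<open>Iterated derivatives on an open set\<close>

text \<open>
  The derivative is an existential witness instead of \<^const>\<open>deriv\<close>, so that the derivative
  produced by a differentiation rule can be used directly, without rewriting iterates of
  \<^const>\<open>deriv\<close> by equations valid only on \<open>I\<close>.
\<close>

primrec times_differentiable_on :: "nat \<Rightarrow> (real \<Rightarrow> real) \<Rightarrow> real set \<Rightarrow> bool" where
  "times_differentiable_on 0 f I = True"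
| "times_differentiable_on (Suc n) f I =
     (\<exists>f'. (\<forall>x\<in>I. (f has_real_derivative f' x) (at x)) \<and> times_differentiable_on n f' I)"

lemma times_differentiable_on_cong:
  assumes "times_differentiable_on n f I" "open I" "\<And>x. x \<in> I \<Longrightarrow> f x = g x"
  shows "times_differentiable_on n g I"
  using assms
proof (cases n)
  case (Suc m)
  with assms(1) obtain f' where f': "\<forall>x\<in>I. (f has_real_derivative f' x) (at x)"
    and m: "times_differentiable_on m f' I" by auto
  have "\<forall>x\<in>I. (g has_real_derivative f' x) (at x)"
    using f' assms(2,3) has_field_derivative_transform_within_open by blast
  with m Suc show ?thesis by auto
qed simp

lemma times_differentiable_on_SucD:
  "times_differentiable_on (Suc n) f I \<Longrightarrow> times_differentiable_on n f I"
proof (induction n arbitrary: f)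
  case (Suc n)
  then obtain f' where "\<forall>x\<in>I. (f has_real_derivative f' x) (at x)"
    and "times_differentiable_on (Suc n) f' I" by auto
  with Suc.IH[of f'] show ?case by auto
qed simp

lemma times_differentiable_on_add:
  assumes "times_differentiable_on n f I" "times_differentiable_on n g I"
  shows "times_differentiable_on n (\<lambda>x. f x + g x) I"
  using assms
proof (induction n arbitrary: f g)
  case (Suc n)
  then obtain f' g' where
    "\<forall>x\<in>I. (f has_real_derivative f' x) (at x)" "times_differentiable_on n f' I"
    "\<forall>x\<in>I. (g has_real_derivative g' x) (at x)" "times_differentiable_on n g' I" by auto
  with Suc.IH[of f' g'] show ?case
    by (auto intro!: exI[of _ "\<lambda>x. f' x + g' x"] DERIV_add)
qed simp

lemma times_differentiable_on_mult:
  assumes "times_differentiable_on n f I" "times_differentiable_on n g I"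
  shows "times_differentiable_on n (\<lambda>x. f x * g x) I"
  using assms
proof (induction n arbitrary: f g)
  case (Suc n)
  then obtain f' g' where f': "\<forall>x\<in>I. (f has_real_derivative f' x) (at x)"
      "times_differentiable_on n f' I"
    and g': "\<forall>x\<in>I. (g has_real_derivative g' x) (at x)"
      "times_differentiable_on n g' I" by auto
  have "times_differentiable_on n f I" "times_differentiable_on n g I"
    using Suc.prems times_differentiable_on_SucD by blast+
  with Suc.IH f'(2) g'(2)
  have "times_differentiable_on n (\<lambda>x. f' x * g x + g' x * f x) I"
    by (intro times_differentiable_on_add) auto
  moreover have "\<forall>x\<in>I. ((\<lambda>x. f x * g x) has_real_derivative f' x * g x + g' x * f x) (at x)"
    using f'(1) g'(1) DERIV_mult by blast
  ultimately show ?case by auto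
qed simp

text \<open>
  The derivative \<open>exp f * f'\<close> contains \<open>exp f\<close> again, so the induction gains one order of
  differentiability at a time through the product rule.
\<close>

lemma times_differentiable_on_exp:
  assumes "times_differentiable_on n f I"
  shows "times_differentiable_on n (\<lambda>x. exp (f x)) I"
  using assms
proof (induction n)
  case (Suc n)
  then obtain f' where f': "\<forall>x\<in>I. (f has_real_derivative f' x) (at x)"
      "times_differentiable_on n f' I" by auto
  have "times_differentiable_on n (\<lambda>x. exp (f x) * f' x) I"
    using Suc f'(2) times_differentiable_on_SucD times_differentiable_on_mult by blast
  moreover have "\<forall>x\<in>I. ((\<lambda>x. exp (f x)) has_real_derivative exp (f x) * f' x) (at x)"
    using f'(1) DERIV_fun_exp by blast
  ultimately show ?case by auto
qed simp

lemma times_differentiable_on_imp_differentiable: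
  assumes "times_differentiable_on (Suc n) f I" "open I" "x \<in> I"
  shows "(deriv ^^ n) f differentiable (at x)"
  using assms(1)
proof (induction n arbitrary: f)
  case 0
  with assms(3) show ?case by (auto simp: real_differentiable_def)
next
  case (Suc n)
  then obtain f' where f': "\<forall>x\<in>I. (f has_real_derivative f' x) (at x)"
      "times_differentiable_on (Suc n) f' I" by auto
  have "times_differentiable_on (Suc n) (deriv f) I"
    by (rule times_differentiable_on_cong[OF f'(2) assms(2)])
       (use f'(1) in \<open>auto simp: DERIV_imp_deriv\<close>)
  from Suc.IH[OF this] show ?case by (simp add: funpow_swap1)
qed

lemma times_differentiable_on_sequence:
  assumes "\<And>n x. x \<in> I \<Longrightarrow> (F n has_real_derivative F (Suc n) x) (at x)"
  shows "times_differentiable_on n (F k) I"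
proof (induction n arbitrary: k)
  case (Suc n)
  with assms show ?case by (auto intro!: exI[of _ "F (Suc k)"])
qed simp

text \<open>
  The two sides of \<open>f = F 0\<close> may differ outside \<open>I\<close>; the iterated derivatives at a point of \<open>I\<close>
  still agree because \<open>I\<close> is open.
\<close>

lemma deriv_funpow_sequence:
  assumes F: "\<And>n x. x \<in> I \<Longrightarrow> (F n has_real_derivative F (Suc n) x) (at x)"
    and "open I" and f: "\<And>x. x \<in> I \<Longrightarrow> f x = F 0 x" and "x \<in> I"
  shows "(deriv ^^ n) f x = F n x"
  using assms(4)
proof (induction n arbitrary: x)
  case 0
  with f show ?case by simp
next
  case (Suc n)
  have "((deriv ^^ n) f has_real_derivative F (Suc n) x) (at x)"
    by (rule has_field_derivative_transform_within_open[OF F \<open>open I\<close>])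
       (use Suc in auto)
  then show ?case by (simp add: DERIV_imp_deriv)
qed

section \<open>Derivatives of a divided difference\<close>

text \<open>
  The argument \<open>G\<close> stands for a function \<open>G 0\<close> together with all its derivatives \<open>G n\<close>. The
  integral form treats \<open>x = \<beta>\<close> like every other point, so that the removable singularity of
  \<open>(G 0 x - G 0 \<beta>) / (x - \<beta>)\<close> requires no separate argument for the higher derivatives.
\<close>

definition divided_difference_derivs ::
    "(nat \<Rightarrow> real \<Rightarrow> real) \<Rightarrow> real \<Rightarrow> nat \<Rightarrow> real \<Rightarrow> real" where
  "divided_difference_derivs G \<beta> n x =
     integral {0..1} (\<lambda>u. u ^ n * G (Suc n) (\<beta> + u * (x - \<beta>)))"

lemma convex_line_point:
  fixes I :: "real set"
  assumes "convex I" "\<beta> \<in> I" "x \<in> I" "u \<in> {0..1}"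
  shows "\<beta> + u * (x - \<beta>) \<in> I"
  using convexD_alt[OF assms(1-3), of u] assms(4) by (simp add: algebra_simps)

context
  fixes I :: "real set" and G :: "nat \<Rightarrow> real \<Rightarrow> real" and \<beta> :: real
  assumes I: "open I" "convex I" "\<beta> \<in> I"
    and G: "\<And>n x. x \<in> I \<Longrightarrow> (G n has_real_derivative G (Suc n) x) (at x)"
begin

lemma continuous_on_divided_difference_integrand:
  "continuous_on (I \<times> {0..1}) (\<lambda>(x, u). u ^ m * G n (\<beta> + u * (x - \<beta>)))"
proof -
  have "continuous_on I (G n)"
    using G DERIV_isCont continuous_at_imp_continuous_on by blast
  moreover have "continuous_on (I \<times> {0..1}) (\<lambda>z. \<beta> + snd z * (fst z - \<beta>))"
    by (intro continuous_intros)
  moreover have "(\<lambda>z. \<beta> + snd z * (fst z - \<beta>)) ` (I \<times> {0..1}) \<subseteq> I"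
    using convex_line_point[OF I(2,3)] by auto
  ultimately have "continuous_on (I \<times> {0..1}) (\<lambda>z. G n (\<beta> + snd z * (fst z - \<beta>)))"
    by (rule continuous_on_compose2)
  then have "continuous_on (I \<times> {0..1}) (\<lambda>z. snd z ^ m * G n (\<beta> + snd z * (fst z - \<beta>)))"
    by (intro continuous_intros)
  then show ?thesis by (simp add: case_prod_unfold)
qed

lemma integrable_divided_difference_integrand:
  assumes "x \<in> I"
  shows "(\<lambda>u. u ^ m * G n (\<beta> + u * (x - \<beta>))) integrable_on {0..1}"
proof (rule integrable_continuous_real)
  have "continuous_on {0..1} (Pair x :: real \<Rightarrow> real \<times> real)"
    by (intro continuous_intros)
  from continuous_on_compose2[OF continuous_on_divided_difference_integrand[of m n] this] assms
  show "continuous_on {0..1} (\<lambda>u. u ^ m * G n (\<beta> + u * (x - \<beta>)))"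
    by auto
qed

text \<open>
  Leibniz's rule: the derivative of the integrand in \<open>x\<close> brings out one more factor \<open>u\<close> by the
  chain rule and is jointly continuous in \<open>x\<close> and \<open>u\<close>.
\<close>

lemma divided_difference_derivs_step:
  assumes "x \<in> I"
  shows "(divided_difference_derivs G \<beta> n has_real_derivative
           divided_difference_derivs G \<beta> (Suc n) x) (at x)"
proof -
  have "((\<lambda>x. integral (cbox 0 1) (\<lambda>u. u ^ n * G (Suc n) (\<beta> + u * (x - \<beta>)))) has_real_derivative
          integral (cbox 0 1) (\<lambda>u. u ^ Suc n * G (Suc (Suc n)) (\<beta> + u * (x - \<beta>))))
        (at x within I)"
  proof (rule leibniz_rule_field_derivative)
    fix y u :: real
    assume y: "y \<in> I" and u: "u \<in> cbox 0 1"
    have "((\<lambda>y. G (Suc n) (\<beta> + u * (y - \<beta>))) has_real_derivative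
            G (Suc (Suc n)) (\<beta> + u * (y - \<beta>)) * u) (at y)"
      by (rule DERIV_chain2[OF G])
         (use convex_line_point[OF I(2,3) y] u in \<open>auto intro!: derivative_eq_intros\<close>)
    from DERIV_cmult[OF this, of "u ^ n"]
    show "((\<lambda>y. u ^ n * G (Suc n) (\<beta> + u * (y - \<beta>))) has_real_derivative
            u ^ Suc n * G (Suc (Suc n)) (\<beta> + u * (y - \<beta>))) (at y within I)"
      by (simp add: mult_ac has_field_derivative_at_within)
  next
    show "continuous_on (I \<times> cbox 0 1)
            (\<lambda>(x, u). u ^ Suc n * G (Suc (Suc n)) (\<beta> + u * (x - \<beta>)))"
      using continuous_on_divided_difference_integrand[of "Suc n"] by simp
  qed (use assms I integrable_divided_difference_integrand in auto)
  then show ?thesis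
    unfolding divided_difference_derivs_def[abs_def]
    using at_within_open[OF assms I(1)] by simp
qed

text \<open>
  For \<open>x \<noteq> \<beta>\<close> this is the fundamental theorem of calculus along the segment from \<open>\<beta>\<close> to \<open>x\<close>.
\<close>

lemma divided_difference_derivs_0:
  assumes "x \<in> I"
  shows "divided_difference_derivs G \<beta> 0 x =
           (if x = \<beta> then G 1 \<beta> else (G 0 x - G 0 \<beta>) / (x - \<beta>))"
proof (cases "x = \<beta>")
  case True
  then show ?thesis by (simp add: divided_difference_derivs_def)
next
  case False
  have "((\<lambda>u. (x - \<beta>) * G 1 (\<beta> + u * (x - \<beta>))) has_integral
          G 0 (\<beta> + 1 * (x - \<beta>)) - G 0 (\<beta> + 0 * (x - \<beta>))) {0..1}"
  proof (rule fundamental_theorem_of_calculus)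
    fix u :: real
    assume "u \<in> {0..1}"
    then have "((\<lambda>u. G 0 (\<beta> + u * (x - \<beta>))) has_real_derivative
                 G (Suc 0) (\<beta> + u * (x - \<beta>)) * (x - \<beta>)) (at u)"
      by (intro DERIV_chain2[OF G])
         (use convex_line_point[OF I(2,3) assms] in \<open>auto intro!: derivative_eq_intros\<close>)
    then show "((\<lambda>u. G 0 (\<beta> + u * (x - \<beta>))) has_vector_derivative
                 (x - \<beta>) * G 1 (\<beta> + u * (x - \<beta>))) (at u within {0..1})"
      by (simp add: has_real_derivative_iff_has_vector_derivative mult.commute
          has_vector_derivative_at_within)
  qed simp
  then have "(x - \<beta>) * divided_difference_derivs G \<beta> 0 x = G 0 x - G 0 \<beta>"
    by (simp add: divided_difference_derivs_def integral_unique
        flip: integral_mult_right)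
  with False show ?thesis by (simp add: field_simps)
qed

lemma divided_difference_derivs_sign:
  assumes "x \<in> I" and sign: "\<And>y. y \<in> I \<Longrightarrow> (-1) ^ n * G (Suc n) y \<ge> 0"
  shows "(-1) ^ n * divided_difference_derivs G \<beta> n x \<ge> 0"
proof -
  have "0 \<le> integral {0..1} (\<lambda>u. (-1) ^ n * (u ^ n * G (Suc n) (\<beta> + u * (x - \<beta>))))"
  proof (rule integral_nonneg)
    show "(\<lambda>u. (-1) ^ n * (u ^ n * G (Suc n) (\<beta> + u * (x - \<beta>)))) integrable_on {0..1}"
      using integrable_divided_difference_integrand[OF assms(1)]
      by (intro integrable_on_mult_right)
    fix u :: real
    assume u: "u \<in> {0..1}"
    then have "0 \<le> u ^ n * ((-1) ^ n * G (Suc n) (\<beta> + u * (x - \<beta>)))"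
      using sign convex_line_point[OF I(2,3) assms(1)] by simp
    then show "0 \<le> (-1) ^ n * (u ^ n * G (Suc n) (\<beta> + u * (x - \<beta>)))"
      by (simp only: mult.left_commute)
  qed
  then show ?thesis by (simp add: divided_difference_derivs_def)
qed

end

section \<open>The derivatives of the logarithm of the gamma function\<close>

definition qratio :: "real \<Rightarrow> real \<Rightarrow> real" where
  "qratio q y = q powr y / (1 - q powr y)"

text \<open>
  The chain rule with \<open>w' = ln q * w * (1 + w)\<close> turns a derivative in \<open>y\<close> of a polynomial in
  \<open>w = qratio q y\<close> into \<open>ln q\<close> times the operator \<open>P \<mapsto> (w + w\<^sup>2) P'\<close>. Its iterates on \<open>w\<close> are
  versions of the Eulerian polynomials.
\<close>

primrec qratio_poly :: "nat \<Rightarrow> real poly" where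
  "qratio_poly 0 = [:0, 1:]"
| "qratio_poly (Suc n) = [:0, 1, 1:] * pderiv (qratio_poly n)"

lemma coeff_qratio_poly_nonneg: "coeff (qratio_poly n) i \<ge> 0"
proof (induction n arbitrary: i)
  case 0
  show ?case by (auto simp: coeff_pCons split: nat.split)
next
  case (Suc n)
  have "coeff [:0, 1, 1 :: real:] j \<ge> 0" for j
    by (auto simp: coeff_pCons split: nat.split)
  with Suc show ?case
    unfolding qratio_poly.simps coeff_mult coeff_pderiv
    by (intro sum_nonneg mult_nonneg_nonneg) auto
qed

lemma poly_mono_of_coeff_nonneg:
  fixes P :: "real poly"
  assumes "\<And>i. coeff P i \<ge> 0" "0 \<le> x" "x \<le> y"
  shows "poly P x \<le> poly P y"
  unfolding poly_altdef using assms by (intro sum_mono mult_left_mono power_mono) auto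

text \<open>
  The \<open>n\<close>-th derivative of \<^term>\<open>psi_pq p q\<close> on the positive axis; the linear term
  \<open>y * ln [p]\<^sub>q\<close> of \<open>ln (Gamma_pq p q y)\<close> contributes only to \<open>n = 0\<close>.
\<close>

definition polygamma_pq :: "nat \<Rightarrow> real \<Rightarrow> nat \<Rightarrow> real \<Rightarrow> real" where
  "polygamma_pq p q n y = (if n = 0 then ln (qnum q (real p)) else 0)
     + (\<Sum>k=0..p. ln q ^ Suc n * poly (qratio_poly n) (qratio q (y + real k)))"

context
  fixes q :: real
  assumes q: "0 < q" "q < 1"
begin

lemma q_powr_less_1: "y > 0 \<Longrightarrow> q powr y < 1"
  using q powr_less_mono2[of y q 1] by simp

lemma qnum_pos: "y > 0 \<Longrightarrow> qnum q y > 0"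
  using q q_powr_less_1 by (simp add: qnum_def)

lemma qfact_pos: "qfact q p > 0"
  unfolding qfact_def by (intro prod_pos) (auto intro: qnum_pos)

lemma Gamma_pq_pos:
  assumes "p > 0" "y > 0"
  shows "Gamma_pq p q y > 0"
  unfolding Gamma_pq_def using assms qnum_pos[of "real p"] qfact_pos
  by (intro divide_pos_pos mult_pos_pos prod_pos) (auto intro!: qnum_pos)

lemma ln_Gamma_pq:
  assumes "p > 0" "y > 0"
  shows "ln (Gamma_pq p q y) =
    y * ln (qnum q (real p)) + ln (qfact q p) - (\<Sum>k=0..p. ln (qnum q (y + real k)))"
proof -
  have pos: "qnum q (y + real k) > 0" for k using assms by (intro qnum_pos) simp
  have *: "(\<Prod>k=0..p. qnum q (y + real k)) > 0" using pos by (intro prod_pos) auto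
  have "ln (\<Prod>k=0..p. qnum q (y + real k)) = (\<Sum>k=0..p. ln (qnum q (y + real k)))"
    using pos by (intro ln_prod) (auto simp: less_imp_neq[symmetric])
  moreover have "qnum q (real p) > 0" "qfact q p > 0"
    using qnum_pos[of "real p"] qfact_pos assms(1) by auto
  ultimately show ?thesis
    unfolding Gamma_pq_def using * by (subst ln_divide_pos) (auto simp: ln_mult)
qed

lemma DERIV_ln_qnum:
  assumes "y > 0"
  shows "((\<lambda>y. ln (qnum q y)) has_real_derivative - (ln q * qratio q y)) (at y)"
proof -
  have lt: "q powr y < 1" using assms by (rule q_powr_less_1)
  have pw: "((\<lambda>y. q powr y) has_real_derivative ln q * q powr y) (at y)"
    using q by (auto intro!: derivative_eq_intros)
  have "(qnum q has_real_derivative - (ln q * q powr y) / (1 - q)) (at y)"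
    unfolding qnum_def[abs_def] using q by (auto intro!: derivative_eq_intros pw)
  from DERIV_chain2[where f = ln, OF DERIV_ln_divide[OF qnum_pos[OF assms]] this]
  have "((\<lambda>y. ln (qnum q y)) has_real_derivative
          1 / qnum q y * (- (ln q * q powr y) / (1 - q))) (at y)" .
  moreover have "1 / qnum q y * (- (ln q * q powr y) / (1 - q)) = - (ln q * qratio q y)"
    using lt q by (simp add: qratio_def qnum_def)
  ultimately show ?thesis by simp
qed

lemma DERIV_qratio:
  assumes "y > 0"
  shows "(qratio q has_real_derivative ln q * (qratio q y * (1 + qratio q y))) (at y)"
proof -
  have lt: "q powr y < 1" using assms by (rule q_powr_less_1)
  have pw: "((\<lambda>y. q powr y) has_real_derivative ln q * q powr y) (at y)"
    using q by (auto intro!: derivative_eq_intros)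
  show ?thesis
    unfolding qratio_def[abs_def] using lt
    by (auto intro!: derivative_eq_intros pw simp: field_simps)
qed

lemma DERIV_poly_qratio:
  assumes "y > 0"
  shows "((\<lambda>y. poly (qratio_poly n) (qratio q y)) has_real_derivative
           ln q * poly (qratio_poly (Suc n)) (qratio q y)) (at y)"
  using DERIV_chain2[OF poly_DERIV DERIV_qratio[OF assms], of "qratio_poly n"]
  by (simp add: algebra_simps)

lemma DERIV_polygamma_pq:
  assumes "y > 0"
  shows "(polygamma_pq p q n has_real_derivative polygamma_pq p q (Suc n) y) (at y)"
proof -
  have "((\<lambda>y. ln q ^ Suc n * poly (qratio_poly n) (qratio q (y + real k))) has_real_derivative
          ln q ^ Suc (Suc n) * poly (qratio_poly (Suc n)) (qratio q (y + real k))) (at y)" for k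
  proof -
    have "y + real k > 0" using assms by simp
    from DERIV_poly_qratio[OF this, of n]
    have "((\<lambda>y. poly (qratio_poly n) (qratio q (y + real k))) has_real_derivative
            ln q * poly (qratio_poly (Suc n)) (qratio q (y + real k))) (at y)"
      unfolding DERIV_shift .
    from DERIV_cmult[OF this, of "ln q ^ Suc n"] show ?thesis
      by (simp add: mult_ac del: qratio_poly.simps)
  qed
  then have "((\<lambda>y. c + (\<Sum>k=0..p. ln q ^ Suc n * poly (qratio_poly n) (qratio q (y + real k))))
      has_real_derivative
        0 + (\<Sum>k=0..p. ln q ^ Suc (Suc n) * poly (qratio_poly (Suc n)) (qratio q (y + real k))))
      (at y)" for c
    by (intro DERIV_add DERIV_const DERIV_sum)
  then show ?thesis
    unfolding polygamma_pq_def[abs_def] by simp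
qed

lemma DERIV_ln_Gamma_pq:
  assumes "p > 0" "y > 0"
  shows "((\<lambda>y. ln (Gamma_pq p q y)) has_real_derivative polygamma_pq p q 0 y) (at y)"
proof (rule has_field_derivative_transform_within_open)
  show "((\<lambda>y. y * ln (qnum q (real p)) + ln (qfact q p) - (\<Sum>k=0..p. ln (qnum q (y + real k))))
          has_real_derivative polygamma_pq p q 0 y) (at y)"
  proof -
    have "((\<lambda>y. ln (qnum q (y + real k))) has_real_derivative
            - (ln q * qratio q (y + real k))) (at y)" for k
    proof -
      have "y + real k > 0" using assms by simp
      from DERIV_ln_qnum[OF this] show ?thesis unfolding DERIV_shift .
    qed
    then have "((\<lambda>y. \<Sum>k=0..p. ln (qnum q (y + real k))) has_real_derivative
                 (\<Sum>k=0..p. - (ln q * qratio q (y + real k)))) (at y)"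
      by (intro DERIV_sum)
    moreover have "((\<lambda>y. y * ln (qnum q (real p)) + ln (qfact q p)) has_real_derivative
                     ln (qnum q (real p))) (at y)"
      by (auto intro!: derivative_eq_intros)
    ultimately show ?thesis
      using DERIV_diff by (fastforce simp: polygamma_pq_def sum_negf)
  qed
  show "open {0::real<..}" "y \<in> {0<..}" using assms by auto
qed (use assms ln_Gamma_pq in auto)

lemma psi_pq_eq_polygamma_pq:
  assumes "p > 0" "y > 0"
  shows "psi_pq p q y = polygamma_pq p q 0 y"
  unfolding psi_pq_def using DERIV_ln_Gamma_pq[OF assms] by (rule DERIV_imp_deriv)

text \<open>
  Since \<open>ln q < 0\<close>, the sign \<open>(-1)\<^sup>n (ln q)\<^sup>n\<^sup>+\<^sup>1 \<le> 0\<close> reverses the monotonicity of the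
  polynomials, and so does the fact that \<^term>\<open>qratio q\<close> is decreasing.
\<close>

lemma polygamma_pq_alternating_mono:
  assumes "0 < a" "a \<le> b"
  shows "(-1) ^ n * polygamma_pq p q n a \<le> (-1) ^ n * polygamma_pq p q n b"
proof -
  let ?P = "\<lambda>y. poly (qratio_poly n) (qratio q y)"
  have P: "?P (b + real k) \<le> ?P (a + real k)" for k
  proof (rule poly_mono_of_coeff_nonneg[OF coeff_qratio_poly_nonneg])
    have lt: "q powr (a + real k) < 1" "q powr (b + real k) < 1"
      using assms by (auto intro!: q_powr_less_1)
    have le: "q powr (b + real k) \<le> q powr (a + real k)"
      using q assms by (intro powr_mono') auto
    show "0 \<le> qratio q (b + real k)" using lt by (simp add: qratio_def)
    show "qratio q (b + real k) \<le> qratio q (a + real k)"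
      unfolding qratio_def using lt le by (intro frac_le) auto
  qed
  have "(-1) ^ n * ln q ^ Suc n = ln q * (- ln q) ^ n"
    by (simp add: power_minus[of "ln q"])
  also have "\<dots> \<le> 0"
    using q by (intro mult_nonpos_nonneg) auto
  finally have c: "(-1) ^ n * ln q ^ Suc n \<le> 0" .
  have "(\<Sum>k=0..p. (-1) ^ n * ln q ^ Suc n * ?P (a + real k))
          \<le> (\<Sum>k=0..p. (-1) ^ n * ln q ^ Suc n * ?P (b + real k))"
    using P c by (intro sum_mono mult_left_mono_neg)
  then show ?thesis
    by (simp only: polygamma_pq_def distrib_left sum_distrib_left mult.assoc add_left_mono)
qed

end

section \<open>Logarithmic complete monotonicity\<close>

theorem theorem3p4:
  fixes p :: nat and q s t \<alpha> \<beta> :: real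
  assumes "p > 0" and "0 < q" and "q < 1"
    and "s \<noteq> t" and "\<alpha> = min s t" and "\<beta> > - \<alpha>"
    and "s > t"
  shows "log_completely_monotonic_on (h_pq \<beta> p q s t) {- \<alpha><..}"
proof -
  let ?I = "{- \<alpha><..}"
  define G where "G n x = (case n of
      0 \<Rightarrow> ln (Gamma_pq p q (x + s)) - ln (Gamma_pq p q (x + t))
    | Suc m \<Rightarrow> polygamma_pq p q m (x + s) - polygamma_pq p q m (x + t))" for n x
  let ?D = "divided_difference_derivs G \<beta>"
  have pos: "x + s > 0" "x + t > 0" if "x \<in> ?I" for x
    using that assms(5,7) by auto
  have I: "open ?I" "convex ?I" "\<beta> \<in> ?I" using assms(6) by auto
  have G: "(G n has_real_derivative G (Suc n) x) (at x)" if x: "x \<in> ?I" for n x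
  proof (cases n)
    case 0
    have "((\<lambda>x. ln (Gamma_pq p q (x + c))) has_real_derivative polygamma_pq p q 0 (x + c)) (at x)"
      if "x + c > 0" for c
      using DERIV_ln_Gamma_pq[OF assms(2,3,1) that] unfolding DERIV_shift .
    from DERIV_diff[OF this this, of s t] pos[OF x] show ?thesis
      by (simp add: 0 G_def[abs_def])
  next
    case (Suc m)
    have "((\<lambda>x. polygamma_pq p q m (x + c)) has_real_derivative
            polygamma_pq p q (Suc m) (x + c)) (at x)" if "x + c > 0" for c
      using DERIV_polygamma_pq[OF assms(2,3) that, of p m] unfolding DERIV_shift .
    from DERIV_diff[OF this this, of s t] pos[OF x] show ?thesis
      by (simp add: Suc G_def[abs_def])
  qed
  have sign: "(-1) ^ n * G (Suc n) x \<ge> 0" if "x \<in> ?I" for n x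
    using polygamma_pq_alternating_mono[OF assms(2,3) pos(2)[OF that], of "x + s" n p] assms(7)
    by (simp add: G_def right_diff_distrib)
  have D: "(?D n has_real_derivative ?D (Suc n) x) (at x)" if "x \<in> ?I" for n x
    using divided_difference_derivs_step[where G = G, OF I G that] .
  have h: "h_pq \<beta> p q s t x = exp (?D 0 x)" if x: "x \<in> ?I" for x
  proof (cases "x = \<beta>")
    case True
    with divided_difference_derivs_0[where G = G, OF I G x] pos[OF I(3)] show ?thesis
      by (simp add: h_pq_def G_def psi_pq_eq_polygamma_pq[OF assms(2,3,1)])
  next
    case False
    have g: "Gamma_pq p q (\<beta> + s) > 0" "Gamma_pq p q (\<beta> + t) > 0"
      "Gamma_pq p q (x + s) > 0" "Gamma_pq p q (x + t) > 0"
      using Gamma_pq_pos[OF assms(2,3,1)] pos[OF I(3)] pos[OF x] by auto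
    have "ln (Gamma_pq p q (\<beta> + t) / Gamma_pq p q (\<beta> + s)
            * (Gamma_pq p q (x + s) / Gamma_pq p q (x + t))) = G 0 x - G 0 \<beta>"
      using g by (simp add: ln_mult ln_div G_def)
    moreover have "Gamma_pq p q (\<beta> + t) / Gamma_pq p q (\<beta> + s)
            * (Gamma_pq p q (x + s) / Gamma_pq p q (x + t)) \<noteq> 0"
      using g by simp
    ultimately show ?thesis
      using False divided_difference_derivs_0[where G = G, OF I G x] by (simp add: h_pq_def powr_def)
  qed
  show ?thesis
    unfolding log_completely_monotonic_on_def
  proof (intro conjI ballI allI impI)
    show "open ?I" by (rule I(1))
    show "is_interval ?I" using I(2) by (simp add: is_interval_convex_1)
  next
    fix x assume "x \<in> ?I"
    then show "h_pq \<beta> p q s t x > 0" by (simp add: h)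
  next
    fix n x assume x: "x \<in> ?I"
    have "times_differentiable_on (Suc n) (\<lambda>x. exp (?D 0 x)) ?I"
      by (intro times_differentiable_on_exp times_differentiable_on_sequence D)
    then have "times_differentiable_on (Suc n) (h_pq \<beta> p q s t) ?I"
      by (rule times_differentiable_on_cong) (use I(1) h in auto)
    then show "(deriv ^^ n) (h_pq \<beta> p q s t) differentiable (at x)"
      using I(1) x by (rule times_differentiable_on_imp_differentiable)
  next
    fix n :: nat and x assume x: "x \<in> ?I"
    have "(deriv ^^ n) (\<lambda>y. ln (h_pq \<beta> p q s t y)) x = ?D n x"
      by (rule deriv_funpow_sequence[where F = ?D, OF D I(1) _ x]) (simp_all add: h)
    with divided_difference_derivs_sign[where G = G, OF I G x sign]
    show "(-1) ^ n * (deriv ^^ n) (\<lambda>y. ln (h_pq \<beta> p q s t y)) x \<ge> 0" by simp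
  qed
qed

end
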